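(* Let $\varphi$ be a Ma-Minda function with $\varphi(z)=1+B_1z+B_2z^2+B_3z^3+\cdots$, and let $f\in\mathcal{C}(\varphi)$. If $|B_2-\frac54B_1^2|\ge B_1$, then $$|T_{2,1}(F_{f^{-1}})|=|\Gamma_1^2-\Gamma_2^2|\le \frac{B_1^2}{16}+\frac{1}{144}\Big(B_2-\frac54B_1^2\Big)^2 .$$ The inequality is sharp (for each such $\varphi$, equality is attained by some $f\in\mathcal{C}(\varphi)$).
   Context: $\mathbb{U}=\{z\in\mathbb{C}:|z|<1\}$, and $\mathcal{A}$ is the class of analytic functions $f$ on $\mathbb{U}$ of the form $f(z)=z+\sum_{n\ge2}a_nz^n$. For analytic $g,h$ on $\mathbb{U}$, $g\prec h$ (subordination) means there is an analytic $\omega:\mathbb{U}\to\mathbb{C}$ with $\omega(0)=0$, $|\omega(z)|\le1$, and $g=h\circ\omega$. A Ma-Minda function is an analytic univalent $\varphi$ on $\mathbb{U}$ with $\varphi(0)=1$, $\varphi'(0)>0$, mapping $\mathbb{U}$ onto a domain in the right half-plane that is symmetric about the real axis and starlike with respect to $\varphi(0)=1$ (so $B_1>0$ and all $B_n$ are real). $\mathcal{C}(\varphi)=\{f\in\mathcal{A}: 1+zf''(z)/f'(z)\prec\varphi(z)\}$; its members are univalent. The local inverse $f^{-1}$ near $0$ has the logarithmic coefficients $\Gamma_n$ defined by $F_{f^{-1}}(w)=\log\big(f^{-1}(w)/w\big)=2\sum_{n\ge1}\Gamma_nw^n$ (with $\log 1=0$). Equivalently $\Gamma_1=-\tfrac{a_2}{2}$,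 $\Gamma_2=-\tfrac12(a_3-\tfrac32a_2^2)$. Definition: $T_{2,1}(F_{f^{-1}})=\Gamma_1^2-\Gamma_2^2$. *)

theory Defs
  imports "HOL-Complex_Analysis.Complex_Analysis"
begin

abbreviation unit_disc :: "complex set"
  where "unit_disc \<equiv> ball 0 1"

definition class_A :: "(complex \<Rightarrow> complex) set"
  where "class_A = {f. f holomorphic_on unit_disc \<and> f 0 = 0 \<and> deriv f 0 = 1}"

text \<open>
  By the Schwarz lemma such an \<open>\<omega>\<close> maps the disc into the open disc, so \<open>h\<close> is never evaluated
  outside its domain.
\<close>
definition subordinate :: "(complex \<Rightarrow> complex) \<Rightarrow> (complex \<Rightarrow> complex) \<Rightarrow> bool"
    (infix "\<prec>\<^sub>s" 50)
  where "g \<prec>\<^sub>s h \<longleftrightarrow>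
    g holomorphic_on unit_disc \<and> h holomorphic_on unit_disc \<and>
    (\<exists>\<omega>. \<omega> holomorphic_on unit_disc \<and> \<omega> 0 = 0 \<and>
         (\<forall>z\<in>unit_disc. norm (\<omega> z) \<le> 1) \<and> (\<forall>z\<in>unit_disc. g z = h (\<omega> z)))"

text \<open>
  The library's \<^const>\<open>starlike\<close> leaves the centre existentially quantified, whereas here it has
  to be \<open>\<phi> 0 = 1\<close>. The image is a domain automatically, as \<open>\<phi>\<close> is injective and holomorphic.
\<close>
definition ma_minda :: "(complex \<Rightarrow> complex) \<Rightarrow> bool"
  where "ma_minda \<phi> \<longleftrightarrow>
    \<phi> holomorphic_on unit_disc \<and> inj_on \<phi> unit_disc \<and>
    \<phi> 0 = 1 \<and> deriv \<phi> 0 \<in> \<real> \<and> Re (deriv \<phi> 0) > 0 \<and>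
    \<phi> ` unit_disc \<subseteq> {w. Re w > 0} \<and>
    cnj ` \<phi> ` unit_disc = \<phi> ` unit_disc \<and>
    (\<forall>w\<in>\<phi> ` unit_disc. closed_segment 1 w \<subseteq> \<phi> ` unit_disc)"

text \<open>
  The condition that \<open>deriv f\<close> has no zeros is implicit in the usual notation; it excludes the
  totalised value \<open>x / 0 = 0\<close>.
\<close>
definition class_C :: "(complex \<Rightarrow> complex) \<Rightarrow> (complex \<Rightarrow> complex) set"
  where "class_C \<phi> = {f \<in> class_A. (\<forall>z\<in>unit_disc. deriv f z \<noteq> 0) \<and>
    (\<lambda>z. 1 + z * deriv (deriv f) z / deriv f z) \<prec>\<^sub>s \<phi>}"

definition is_local_inverse :: "(complex \<Rightarrow> complex) \<Rightarrow> (complex \<Rightarrow> complex) \<Rightarrow> bool"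
  where "is_local_inverse f g \<longleftrightarrow>
    g analytic_on {0} \<and> g 0 = 0 \<and> (\<forall>\<^sub>F w in nhds 0. f (g w) = w)"

text \<open>Only the germ at \<open>0\<close> of the chosen function matters, and that germ is unique (see below).\<close>
definition local_inverse :: "(complex \<Rightarrow> complex) \<Rightarrow> complex \<Rightarrow> complex"
  where "local_inverse f = (SOME g. is_local_inverse f g)"

text \<open>
  The quotient \<open>local_inverse f w / w\<close> tends to \<open>1\<close> as \<open>w\<close> tends to \<open>0\<close>, so near \<open>0\<close> the
  branch of the logarithm with \<open>log 1 = 0\<close> is the principal one; the removable singularity at \<open>0\<close>
  is filled with \<open>log 1\<close>.
\<close>
definition F_inv :: "(complex \<Rightarrow> complex) \<Rightarrow> complex \<Rightarrow> complex"
  where "F_inv f w = (if w = 0 then 0 else Ln (local_inverse f w / w))"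

definition inv_log_coeff :: "(complex \<Rightarrow> complex) \<Rightarrow> nat \<Rightarrow> complex"
  where "inv_log_coeff f n = fps_nth (fps_expansion (F_inv f) 0) n / 2"

definition T21_inv :: "(complex \<Rightarrow> complex) \<Rightarrow> complex"
  where "T21_inv f = (inv_log_coeff f 1)\<^sup>2 - (inv_log_coeff f 2)\<^sup>2"

lemma is_local_inverse_unique:
  assumes "f \<in> class_A" "is_local_inverse f g" "is_local_inverse f h"
  shows "\<forall>\<^sub>F w in nhds 0. g w = h w"
proof -
  obtain r where r: "r > 0" "inj_on f (ball 0 r)"
    using has_complex_derivative_locally_invertible[of f unit_disc 0] assms(1)
    unfolding class_A_def by (metis (mono_tags, lifting) centre_in_ball mem_Collect_eq open_ball zero_less_one zero_neq_one)
  have small: "\<forall>\<^sub>F w in nhds 0. k w \<in> ball 0 r" if "is_local_inverse f k" for k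
  proof -
    have "k analytic_on {0}" and k0: "k 0 = 0"
      using that unfolding is_local_inverse_def by auto
    then have "isCont k 0"
      by (simp add: analytic_at_imp_isCont)
    then have "filterlim k (nhds (k 0)) (nhds 0)"
      by (simp add: isCont_def tendsto_at_iff_tendsto_nhds)
    then show ?thesis
      by (rule topological_tendstoD) (use r k0 in auto)
  qed
  have "\<forall>\<^sub>F w in nhds 0. f (g w) = w" "\<forall>\<^sub>F w in nhds 0. f (h w) = w"
    using assms unfolding is_local_inverse_def by auto
  with small[OF assms(2)] small[OF assms(3)] show ?thesis
    by eventually_elim (use r(2) in \<open>metis inj_on_def\<close>)
qed

lemma local_inverse_is_local_inverse:
  assumes "f \<in> class_A"
  shows "is_local_inverse f (local_inverse f)"
proof -
  have f: "f holomorphic_on unit_disc" "f 0 = 0" "deriv f 0 = 1"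
    using assms by (auto simp: class_A_def)
  obtain r where r: "r > 0" "ball 0 r \<subseteq> unit_disc" "open (f ` ball 0 r)" "inj_on f (ball 0 r)"
    using has_complex_derivative_locally_invertible[of f unit_disc 0] f
    by (metis centre_in_ball open_ball zero_less_one zero_neq_one)
  have "f holomorphic_on ball 0 r"
    using f(1) r(2) by (rule holomorphic_on_subset)
  then obtain g where g: "g holomorphic_on (f ` ball 0 r)" "\<And>z. z \<in> ball 0 r \<Longrightarrow> g (f z) = z"
    using holomorphic_has_inverse[OF _ open_ball r(4)] by metis
  have 0: "0 \<in> f ` ball 0 r"
    using r(1) f(2) by (metis centre_in_ball image_eqI)
  have "g analytic_on {0}"
    using g(1) r(3) 0 by (metis analytic_at)
  moreover have "g 0 = 0"
    using g(2)[of 0] f(2) r(1) by simp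
  moreover have "\<forall>\<^sub>F w in nhds 0. f (g w) = w"
    using eventually_nhds_in_open[OF r(3) 0] by eventually_elim (use g(2) in auto)
  ultimately have "is_local_inverse f g"
    by (simp add: is_local_inverse_def)
  then show ?thesis
    unfolding local_inverse_def by (rule someI[of "is_local_inverse f"])
qed

lemma deriv_local_inverse:
  assumes "f \<in> class_A"
  shows "deriv (local_inverse f) 0 = 1"
proof -
  let ?g = "local_inverse f"
  have f: "f holomorphic_on unit_disc" "f 0 = 0" "deriv f 0 = 1"
    using assms by (auto simp: class_A_def)
  have g: "?g analytic_on {0}" "?g 0 = 0" "\<forall>\<^sub>F w in nhds 0. f (?g w) = w"
    using local_inverse_is_local_inverse[OF assms] by (auto simp: is_local_inverse_def)
  have "(f has_field_derivative 1) (at 0)"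
    using holomorphic_derivI[OF f(1) open_ball, of 0] f(3) by simp
  moreover have "(?g has_field_derivative deriv ?g 0) (at 0)"
    using g(1) analytic_on_imp_differentiable_at DERIV_deriv_iff_field_differentiable by blast
  ultimately have "((\<lambda>w. f (?g w)) has_field_derivative 1 * deriv ?g 0) (at 0)"
    using g(2) by (intro DERIV_chain2) auto
  then have "((\<lambda>w. w) has_field_derivative deriv ?g 0) (at 0)"
    using DERIV_cong_ev[OF refl g(3) refl, of "deriv ?g 0"] by simp
  then show ?thesis
    using DERIV_ident DERIV_unique by blast
qed

lemma F_inv_analytic:
  assumes "f \<in> class_A"
  shows "F_inv f analytic_on {0}"
proof -
  let ?g = "local_inverse f"
  have g: "?g analytic_on {0}" "?g 0 = 0"
    using local_inverse_is_local_inverse[OF assms] by (auto simp: is_local_inverse_def)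
  obtain S where S: "open S" "0 \<in> S" "?g holomorphic_on S"
    using g(1) analytic_at by metis
  define q where "q = (\<lambda>w. if w = 0 then deriv ?g 0 else (?g w - ?g 0) / (w - 0))"
  have "q holomorphic_on S"
    unfolding q_def by (rule pole_lemma_open[OF S(3,1)])
  then have "q analytic_on {0}"
    using S analytic_at by blast
  moreover have "q 0 = 1"
    using deriv_local_inverse[OF assms] by (simp add: q_def)
  ultimately have "(\<lambda>w. Ln (q w)) analytic_on {0}"
    by (intro analytic_intros) auto
  moreover have "(\<lambda>w. Ln (q w)) = F_inv f"
    using deriv_local_inverse[OF assms] g(2) by (auto simp: q_def F_inv_def)
  ultimately show ?thesis
    by simp
qed

lemma F_inv_sums:
  assumes "f \<in> class_A"
  shows "inv_log_coeff f 0 = 0"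
    and "\<forall>\<^sub>F w in nhds 0. (\<lambda>n. 2 * inv_log_coeff f n * w ^ n) sums F_inv f w"
proof -
  show "inv_log_coeff f 0 = 0"
    by (simp add: inv_log_coeff_def fps_expansion_def F_inv_def)
  obtain r where r: "r > 0" "F_inv f holomorphic_on ball 0 r"
    using F_inv_analytic[OF assms] by (auto simp: analytic_on_def)
  have "\<forall>\<^sub>F w in nhds 0. w \<in> ball (0::complex) r"
    using r(1) by (intro eventually_nhds_in_open) auto
  then show "\<forall>\<^sub>F w in nhds 0. (\<lambda>n. 2 * inv_log_coeff f n * w ^ n) sums F_inv f w"
    by eventually_elim
      (use holomorphic_power_series[OF r(2)] in \<open>simp add: inv_log_coeff_def fps_expansion_def\<close>)
qed

lemma ma_minda_cnj:
  assumes "ma_minda \<phi>" "z \<in> unit_disc"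
  shows "cnj (\<phi> (cnj z)) = \<phi> z"
proof -
  define h where "h = (\<lambda>z. cnj (\<phi> (cnj z)))"
  have \<phi>: "\<phi> holomorphic_on unit_disc" "inj_on \<phi> unit_disc" "\<phi> 0 = 1" "deriv \<phi> 0 \<in> \<real>"
      "Re (deriv \<phi> 0) > 0" "cnj ` \<phi> ` unit_disc = \<phi> ` unit_disc"
    using assms(1) by (auto simp: ma_minda_def)
  obtain g where g: "g holomorphic_on (\<phi> ` unit_disc)"
      "\<And>z. z \<in> unit_disc \<Longrightarrow> deriv \<phi> z * deriv g (\<phi> z) = 1"
      "\<And>z. z \<in> unit_disc \<Longrightarrow> g (\<phi> z) = z"
    using holomorphic_has_inverse[OF \<phi>(1) open_ball \<phi>(2)] by metis
  have opn: "open (\<phi> ` unit_disc)"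
    using open_mapping_thm3[OF \<phi>(1) open_ball \<phi>(2)] .
  have h_in: "h z \<in> \<phi> ` unit_disc" if "z \<in> unit_disc" for z
  proof -
    have "h z \<in> cnj ` \<phi> ` unit_disc"
      unfolding h_def using that by (intro imageI) simp
    then show ?thesis using \<phi>(6) by simp
  qed
  have der\<phi>: "(\<phi> has_field_derivative deriv \<phi> z) (at z)" if "z \<in> unit_disc" for z
    using holomorphic_derivI[OF \<phi>(1) open_ball that] .
  have derh: "(h has_field_derivative cnj (deriv \<phi> (cnj z))) (at z)" if "z \<in> unit_disc" for z
  proof -
    have "((cnj \<circ> \<phi> \<circ> cnj) has_field_derivative cnj (deriv \<phi> (cnj z))) (at z)"
      using der\<phi>[of "cnj z"] that by (intro has_field_derivative_cnj_cnj) auto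
    then show ?thesis by (simp add: h_def o_def)
  qed
  have holh: "h holomorphic_on unit_disc"
    unfolding holomorphic_on_open[OF open_ball] using derh by blast
  define k where "k = g \<circ> h"
  have holk: "k holomorphic_on unit_disc"
    unfolding k_def by (rule holomorphic_on_compose_gen[OF holh g(1)]) (use h_in in auto)
  have k_in: "k z \<in> unit_disc \<and> \<phi> (k z) = h z" if "z \<in> unit_disc" for z
    using h_in[OF that] g(3) by (auto simp: k_def)
  have h0: "h 0 = 1" and k0: "k 0 = 0"
    using \<phi>(3) g(3)[of 0] by (auto simp: h_def k_def)
  have "(g has_field_derivative deriv g 1) (at (h 0))"
    using holomorphic_derivI[OF g(1) opn, of 1] h_in[of 0] h0 by simp
  from DERIV_chain[OF this derh[of 0]]
  have "(k has_field_derivative deriv g 1 * cnj (deriv \<phi> 0)) (at 0)"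
    by (simp add: k_def)
  moreover have "deriv g 1 * cnj (deriv \<phi> 0) = 1"
    using g(2)[of 0] \<phi>(3,4) by (simp add: mult.commute Reals_cnj_iff)
  ultimately have dk: "(k has_field_derivative 1) (at 0)"
    by simp
  then have "deriv k 0 = 1"
    by (rule DERIV_imp_deriv)
  then obtain \<alpha> where \<alpha>: "\<And>z. norm z < 1 \<Longrightarrow> k z = \<alpha> * z"
    using Schwarz_Lemma(3)[OF holk k0, of 0] k_in by auto
  have "\<forall>\<^sub>F w in nhds 0. w \<in> unit_disc"
    by (intro eventually_nhds_in_open) auto
  then have "\<forall>\<^sub>F w in nhds 0. k w = \<alpha> * w"
    by eventually_elim (use \<alpha> in auto)
  from DERIV_cong_ev[OF refl this refl, of 1] dk
  have "((\<lambda>w. \<alpha> * w) has_field_derivative 1) (at 0)" by simp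
  moreover have "((\<lambda>w. \<alpha> * w) has_field_derivative \<alpha>) (at 0)"
    by (auto intro!: derivative_eq_intros)
  ultimately have "\<alpha> = 1"
    using DERIV_unique by blast
  then show ?thesis
    using k_in[OF assms(2)] \<alpha>[of z] assms(2) by (simp add: h_def)
qed

text \<open>Thus assuming a real coefficient sequence for a Ma-Minda function is no restriction.\<close>
lemma ma_minda_real_coeffs:
  assumes "ma_minda \<phi>"
  shows "\<exists>B :: nat \<Rightarrow> real. \<forall>z\<in>unit_disc. (\<lambda>n. of_real (B n) * z ^ n) sums \<phi> z"
proof (intro exI ballI)
  let ?c = "\<lambda>n. (deriv ^^ n) \<phi> 0 / fact n"
  fix z :: complex assume z: "z \<in> unit_disc"
  have hol: "\<phi> holomorphic_on unit_disc"
    using assms by (simp add: ma_minda_def)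
  have 1: "(\<lambda>n. ?c n * z ^ n) sums \<phi> z"
    using holomorphic_power_series[OF hol z] by simp
  have "(\<lambda>n. ?c n * cnj z ^ n) sums \<phi> (cnj z)"
    using holomorphic_power_series[OF hol, of "cnj z"] z by simp
  then have "(\<lambda>n. cnj (?c n * cnj z ^ n)) sums cnj (\<phi> (cnj z))"
    by (simp only: sums_cnj)
  then have 2: "(\<lambda>n. cnj (?c n) * z ^ n) sums \<phi> z"
    using ma_minda_cnj[OF assms z] by simp
  have "(\<lambda>n. (?c n * z ^ n + cnj (?c n) * z ^ n) / 2) sums ((\<phi> z + \<phi> z) / 2)"
    by (intro sums_divide sums_add 1 2)
  moreover have "(?c n * z ^ n + cnj (?c n) * z ^ n) / 2 = of_real (Re (?c n)) * z ^ n" for n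
  proof -
    have "(?c n * z ^ n + cnj (?c n) * z ^ n) / 2 = (?c n + cnj (?c n)) / 2 * z ^ n"
      by (simp only: ring_distribs times_divide_eq_left)
    then show ?thesis by (simp only: complex_add_cnj) simp
  qed
  ultimately show "(\<lambda>n. of_real (Re (?c n)) * z ^ n) sums \<phi> z"
    by simp
qed

end

theory Submission
  imports Defs
begin

text \<open>
  If \<open>1 + z f'' / f' = \<phi> \<circ> \<omega>\<close> with \<open>\<omega> z = c\<^sub>1 z + c\<^sub>2 z\<^sup>2 + \<dots>\<close>, comparing coefficients gives
  \<open>\<Gamma>\<^sub>1 = - B\<^sub>1 c\<^sub>1 / 4\<close> and \<open>\<Gamma>\<^sub>2 = - (B\<^sub>1 c\<^sub>2 + M c\<^sub>1\<^sup>2) / 12\<close>, where \<open>M = B\<^sub>2 - 5 B\<^sub>1\<^sup>2 / 4\<close>. By the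
  Schwarz-Pick inequality \<open>\<bar>c\<^sub>2\<bar> \<le> 1 - \<bar>c\<^sub>1\<bar>\<^sup>2\<close>, so \<open>\<bar>M\<bar> \<ge> B\<^sub>1\<close> yields
  \<open>\<bar>\<Gamma>\<^sub>2\<bar> \<le> \<bar>M\<bar> / 12\<close>, and \<open>\<bar>\<Gamma>\<^sub>1\<bar> \<le> B\<^sub>1 / 4\<close>. For \<open>\<omega> z = \<i> z\<close> the square \<open>\<Gamma>\<^sub>1\<^sup>2\<close> is negative
  while \<open>\<Gamma>\<^sub>2\<^sup>2\<close> is positive, and both bounds are attained, so that equality holds.
\<close>

section \<open>Formal power series: composition in low degrees and uniqueness of expansions\<close>

lemma fps_compose_low_nth:
  fixes a b :: "'a :: comm_ring_1 fps"
  assumes "fps_nth b 0 = 0"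
  shows "fps_nth (a oo b) 1 = fps_nth a 1 * fps_nth b 1"
    and "fps_nth (a oo b) 2 = fps_nth a 1 * fps_nth b 2 + fps_nth a 2 * fps_nth b 1 ^ 2"
    and "fps_nth (a oo b) 3 = fps_nth a 1 * fps_nth b 3
           + 2 * fps_nth a 2 * fps_nth b 1 * fps_nth b 2 + fps_nth a 3 * fps_nth b 1 ^ 3"
  using assms
  by (simp_all add: fps_compose_nth fps_mult_nth power_Suc0_right numeral_eq_Suc algebra_simps)

text \<open>Serves to turn a functional identity near 0 into an identity of formal power series,
  from which coefficients can be read off.\<close>

lemma fps_expansion_eq:
  fixes F G :: "complex fps"
  assumes "\<forall>\<^sub>F z in nhds 0. f z = g z" "f has_fps_expansion F" "g has_fps_expansion G"
  shows "F = G"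
proof -
  have "g has_fps_expansion F"
    using assms(2) has_fps_expansion_cong[OF assms(1) refl, of F] by simp
  then show ?thesis
    using assms(3) by (rule fps_expansion_unique_complex)
qed

section \<open>Coefficient estimates for Schwarz functions\<close>

text \<open>Maximum modulus principle. Subordination supplies only the bound
  \<open>norm (\<omega> z) \<le> 1\<close>, whereas the Schwarz lemma and the disc automorphisms are
  applied to functions with values in the open disc.\<close>

lemma norm_less_one_or_constant:
  assumes hol: "f holomorphic_on unit_disc"
    and le: "\<And>z. z \<in> unit_disc \<Longrightarrow> norm (f z) \<le> 1"
  shows "(\<forall>z\<in>unit_disc. norm (f z) < 1) \<or> f constant_on unit_disc"
proof (cases "\<forall>z\<in>unit_disc. norm (f z) < 1")
  case False
  then obtain \<xi> where \<xi>: "\<xi> \<in> unit_disc" "norm (f \<xi>) \<ge> 1"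
    by (auto simp: not_less)
  have "f constant_on unit_disc"
    by (rule maximum_modulus_principle[OF hol open_ball connected_ball open_ball subset_refl \<xi>(1)])
      (use le \<xi>(2) order_trans in blast)
  then show ?thesis ..
qed auto

text \<open>In the non-constant case, the disc automorphism that sends \<open>f 0\<close> to 0
  reduces the claim to the Schwarz lemma for the composite; a constant has derivative 0.\<close>

lemma Schwarz_Pick_deriv_0:
  assumes hol: "f holomorphic_on unit_disc"
    and le: "\<And>z. z \<in> unit_disc \<Longrightarrow> norm (f z) \<le> 1"
  shows "norm (deriv f 0) \<le> 1 - (norm (f 0))\<^sup>2"
  using norm_less_one_or_constant[OF assms]
proof
  assume lt: "\<forall>z\<in>unit_disc. norm (f z) < 1"
  define a where "a = f 0"
  define h where "h = Moebius_function 0 a \<circ> f"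
  have a: "norm a < 1"
    using lt by (simp add: a_def)
  have holh: "h holomorphic_on unit_disc"
    unfolding h_def
    by (rule holomorphic_on_compose_gen[OF hol Moebius_function_holomorphic[OF a]])
      (use lt in auto)
  have h0: "h 0 = 0"
    by (simp add: h_def a_def Moebius_function_def)
  have "norm (h z) < 1" if "norm z < 1" for z
    using Moebius_function_norm_lt_1[OF a] lt that by (simp add: h_def)
  from Schwarz_Lemma(2)[OF holh h0 this, of 0] have dh: "norm (deriv h 0) \<le> 1"
    by simp
  define k where "k = 1 - cnj a * a"
  have k: "k = of_real (1 - (norm a)\<^sup>2)"
    by (simp add: k_def complex_norm_square mult.commute del: of_real_power)
  have pos: "1 - (norm a)\<^sup>2 > 0"
    using a by (simp add: abs_square_less_1)
  then have k0: "k \<noteq> 0"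
    using k by (metis less_irrefl of_real_eq_0_iff)
  have df: "(f has_field_derivative deriv f 0) (at 0)"
    using holomorphic_derivI[OF hol open_ball, of 0] by simp
  \<comment> \<open>At 0 the numerator \<open>f z - a\<close> vanishes, so the quotient rule leaves
    only the derivative of the numerator divided by the value \<open>k\<close> of the
    denominator.\<close>
  have "((\<lambda>z. (f z - a) / (1 - cnj a * f z)) has_field_derivative deriv f 0 / k) (at 0)"
    using k0 by (auto intro!: derivative_eq_intros df simp: k_def a_def)
  moreover have "h = (\<lambda>z. (f z - a) / (1 - cnj a * f z))"
    by (auto simp: h_def Moebius_function_def)
  ultimately have "deriv h 0 = deriv f 0 / k"
    by (simp add: DERIV_imp_deriv)
  then have "norm (deriv f 0) / norm k \<le> 1"
    using dh by (simp add: norm_divide)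
  moreover have "norm k = 1 - (norm a)\<^sup>2"
    using pos by (simp only: k norm_of_real)
  ultimately show ?thesis
    using pos by (simp add: a_def)
next
  assume "f constant_on unit_disc"
  then obtain c where c: "\<And>z. z \<in> unit_disc \<Longrightarrow> f z = c"
    by (auto simp: constant_on_def)
  have "\<forall>\<^sub>F z in nhds 0. z \<in> unit_disc"
    by (intro eventually_nhds_in_open) auto
  then have "\<forall>\<^sub>F z in nhds 0. f z = c"
    by eventually_elim (use c in auto)
  then have "deriv f 0 = 0"
    using deriv_cong_ev[of f "\<lambda>_. c" 0 0] by simp
  moreover have "norm (f 0) \<le> 1"
    using le by simp
  ultimately show ?thesis
    by (simp add: abs_square_le_1)
qed

text \<open>Dividing by z gives \<open>\<omega> z = z * h z\<close> with \<open>h\<close> still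
  bounded by 1. The first two coefficients of \<open>\<omega>\<close> are then \<open>h 0\<close>
  and \<open>deriv h 0\<close>, so the Schwarz-Pick inequality at 0 applies.\<close>

lemma schwarz_function_coeffs:
  assumes hol: "\<omega> holomorphic_on unit_disc" and "\<omega> 0 = 0"
    and le: "\<And>z. z \<in> unit_disc \<Longrightarrow> norm (\<omega> z) \<le> 1"
    and W: "\<omega> has_fps_expansion W"
  shows "norm (fps_nth W 2) \<le> 1 - (norm (fps_nth W 1))\<^sup>2"
proof -
  have "norm (\<omega> z) < 1" if "z \<in> unit_disc" for z
    using norm_less_one_or_constant[OF hol le]
  proof
    assume "\<omega> constant_on unit_disc"
    then have "\<omega> z = \<omega> 0"
      unfolding constant_on_def using that by (metis centre_in_ball zero_less_one)
    then show ?thesis using \<open>\<omega> 0 = 0\<close> by simp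
  qed (use that in auto)
  then have lt: "norm (\<omega> z) < 1" if "norm z < 1" for z
    using that by simp
  obtain h where h: "h holomorphic_on unit_disc" "\<And>z. norm z < 1 \<Longrightarrow> \<omega> z = z * h z"
      "deriv \<omega> 0 = h 0"
    using Schwarz3[OF hol \<open>\<omega> 0 = 0\<close>] by blast
  have "norm (h z) \<le> 1" if "z \<in> unit_disc" for z
  proof (cases "z = 0")
    case True
    then show ?thesis
      using Schwarz_Lemma(2)[OF hol \<open>\<omega> 0 = 0\<close> lt, of 0] h(3) by simp
  next
    case False
    then show ?thesis
      using Schwarz_Lemma(1)[OF hol \<open>\<omega> 0 = 0\<close> lt, of z] h(2)[of z] that
      by (simp add: norm_mult)
  qed
  from Schwarz_Pick_deriv_0[OF h(1) this]
  have *: "norm (deriv h 0) \<le> 1 - (norm (h 0))\<^sup>2" .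
  obtain H where H: "h has_fps_expansion H"
    using has_fps_expansion_fps_expansion[OF open_ball _ h(1)] by auto
  have "\<forall>\<^sub>F z in nhds 0. z \<in> unit_disc"
    by (intro eventually_nhds_in_open) auto
  then have "\<forall>\<^sub>F z in nhds 0. \<omega> z = z * h z"
    by eventually_elim (use h(2) in auto)
  then have "W = fps_X * H"
    by (rule fps_expansion_eq) (intro W H fps_expansion_intros)+
  moreover have "fps_nth H 0 = h 0" "fps_nth H 1 = deriv h 0"
    by (simp_all add: fps_nth_fps_expansion[OF H])
  ultimately show ?thesis
    using * by simp
qed

section \<open>Logarithmic coefficients of the inverse in terms of Taylor coefficients\<close>

text \<open>Near 0 the inverse equals \<open>w * exp (F_inv f w)\<close>. With \<open>G\<close> its
  expansion, \<open>F oo G = fps_X\<close>, and the coefficients of degrees 2 and 3 determine the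
  first two coefficients of \<open>F_inv f\<close> in turn.\<close>

lemma inv_log_coeff_1_2:
  assumes f: "f \<in> class_A" and F: "f has_fps_expansion F"
  shows "inv_log_coeff f 1 = - fps_nth F 2 / 2"
    and "inv_log_coeff f 2 = - (fps_nth F 3 - 3 / 2 * (fps_nth F 2)\<^sup>2) / 2"
proof -
  let ?g = "local_inverse f"
  define L where "L = fps_expansion (F_inv f) 0"
  have L: "F_inv f has_fps_expansion L"
    unfolding L_def by (rule analytic_at_imp_has_fps_expansion_0[OF F_inv_analytic[OF f]])
  have L0: "fps_nth L 0 = 0"
    using fps_nth_fps_expansion[OF L, of 0] by (simp add: F_inv_def)
  have F01: "fps_nth F 0 = 0" "fps_nth F 1 = 1"
    using f by (simp_all add: fps_nth_fps_expansion[OF F] class_A_def)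
  define G where "G = fps_X * (fps_exp 1 oo L)"
  have "(exp \<circ> F_inv f) has_fps_expansion (fps_exp 1 oo L)"
    by (intro has_fps_expansion_compose has_fps_expansion_exp1 L L0)
  then have G: "(\<lambda>w. w * exp (F_inv f w)) has_fps_expansion G"
    unfolding G_def using has_fps_expansion_mult[OF has_fps_expansion_fps_X] by (simp add: o_def)
  have G0: "fps_nth G 0 = 0"
    by (simp add: G_def)
  have "\<forall>\<^sub>F w in nhds 0. f (?g w) = w"
    using local_inverse_is_local_inverse[OF f] by (simp add: is_local_inverse_def)
  \<comment> \<open>For w other than 0, \<open>f (?g w) = w\<close> forces \<open>?g w\<close> to be
    nonzero, so \<open>exp\<close> undoes \<open>Ln\<close> whatever the branch. At w = 0 the factor
    w makes the value of \<open>F_inv f\<close> irrelevant.\<close>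
  then have "\<forall>\<^sub>F w in nhds 0. f (w * exp (F_inv f w)) = w"
  proof eventually_elim
    case (elim w)
    have f0: "f 0 = 0"
      using f by (simp add: class_A_def)
    show ?case
    proof (cases "w = 0")
      case False
      then have "?g w \<noteq> 0"
        using elim f0 by metis
      then have "w * exp (F_inv f w) = ?g w"
        using False by (simp add: F_inv_def)
      then show ?thesis using elim by simp
    qed (simp add: f0)
  qed
  moreover have "(\<lambda>w. f (w * exp (F_inv f w))) has_fps_expansion (F oo G)"
    using has_fps_expansion_compose[OF F G G0] by (simp add: o_def)
  ultimately have eq: "F oo G = fps_X"
    using has_fps_expansion_fps_X by (rule fps_expansion_eq)
  define l1 l2 where "l1 = fps_nth L 1" and "l2 = fps_nth L 2"
  have G1: "fps_nth G 1 = 1"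
    by (simp add: G_def fps_compose_nth_0)
  \<comment> \<open>The factor \<open>fps_X\<close> shifts the index by one: these are the
    coefficients of degrees 1 and 2 of the exponential of \<open>L\<close>.\<close>
  have G2: "fps_nth G 2 = l1"
    using fps_compose_low_nth(1)[OF L0, of "fps_exp 1"] by (simp add: G_def l1_def)
  have G3: "fps_nth G 3 = l2 + l1\<^sup>2 / 2"
    using fps_compose_low_nth(2)[OF L0, of "fps_exp 1"]
    by (simp add: G_def l1_def l2_def fact_numeral)
  have "l1 + fps_nth F 2 = 0"
    using fps_compose_low_nth(2)[OF G0, of F] by (simp add: eq F01 G1 G2 del: One_nat_def)
  then have l1: "l1 = - fps_nth F 2"
    by (simp add: eq_neg_iff_add_eq_0)
  have "l2 + l1\<^sup>2 / 2 + 2 * fps_nth F 2 * l1 + fps_nth F 3 = 0"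
    using fps_compose_low_nth(3)[OF G0, of F] by (simp add: eq F01 G1 G2 G3 del: One_nat_def)
  then have l2: "l2 = - (fps_nth F 3 - 3 / 2 * (fps_nth F 2)\<^sup>2)"
    by (simp add: l1 eq_neg_iff_add_eq_0 power2_eq_square algebra_simps)
  have "inv_log_coeff f 1 = l1 / 2" "inv_log_coeff f 2 = l2 / 2"
    by (simp_all only: inv_log_coeff_def L_def l1_def l2_def)
  then show "inv_log_coeff f 1 = - fps_nth F 2 / 2"
    "inv_log_coeff f 2 = - (fps_nth F 3 - 3 / 2 * (fps_nth F 2)\<^sup>2) / 2"
    by (simp_all only: l1 l2)
qed

text \<open>Clearing the denominator \<open>deriv f z\<close> turns the hypothesis into a power
  series identity. Its coefficients of degrees 1 and 2 give a2 and a3 in terms of \<open>B\<close>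
  and \<open>W\<close>, to be inserted in the formulas for the inverse.\<close>

lemma inv_log_coeff_convex:
  fixes B :: "nat \<Rightarrow> real"
  assumes f: "f \<in> class_A" "\<And>z. z \<in> unit_disc \<Longrightarrow> deriv f z \<noteq> 0"
    and \<phi>: "\<And>z. z \<in> unit_disc \<Longrightarrow> (\<lambda>n. complex_of_real (B n) * z ^ n) sums \<phi> z" "\<phi> 0 = 1"
    and W: "\<omega> has_fps_expansion W" "\<omega> 0 = 0"
    and eq: "\<And>z. z \<in> unit_disc \<Longrightarrow> 1 + z * deriv (deriv f) z / deriv f z = \<phi> (\<omega> z)"
  shows "inv_log_coeff f 1 = - of_real (B 1) * fps_nth W 1 / 4"
    and "inv_log_coeff f 2 =
      - (of_real (B 1) * fps_nth W 2 + of_real (B 2 - 5 / 4 * (B 1)\<^sup>2) * (fps_nth W 1)\<^sup>2) / 12"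
proof -
  have "f holomorphic_on unit_disc"
    using f(1) by (simp add: class_A_def)
  from has_fps_expansion_fps_expansion[OF open_ball _ this]
  obtain F where F: "f has_fps_expansion F"
    by auto
  have F1: "fps_nth F 1 = 1"
    using f(1) by (simp add: fps_nth_fps_expansion[OF F] class_A_def)
  define P where "P = Abs_fps (\<lambda>n. complex_of_real (B n))"
  have disc: "\<forall>\<^sub>F z in nhds 0. z \<in> unit_disc"
    by (intro eventually_nhds_in_open) auto
  then have "\<forall>\<^sub>F z in nhds 0. (\<lambda>n. fps_nth P n * z ^ n) sums \<phi> z"
    by eventually_elim (use \<phi>(1) in \<open>simp add: P_def\<close>)
  then have P: "\<phi> has_fps_expansion P"
    by (rule has_fps_expansionI)
  have P0: "fps_nth P 0 = 1"
    using fps_nth_fps_expansion[OF P, of 0] \<phi>(2) by simp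
  have W0: "fps_nth W 0 = 0"
    using fps_nth_fps_expansion[OF W(1), of 0] W(2) by simp
  have "\<forall>\<^sub>F z in nhds 0. deriv f z + z * deriv (deriv f) z = deriv f z * (\<phi> \<circ> \<omega>) z"
    using disc
  proof eventually_elim
    case (elim z)
    then show ?case
      using f(2)[of z] eq[of z, symmetric] by (simp add: distrib_left)
  qed
  then have fps_eq: "fps_deriv F + fps_X * fps_deriv (fps_deriv F) = fps_deriv F * (P oo W)"
    by (rule fps_expansion_eq) (intro fps_expansion_intros F P W W0)+
  define b1 b2 where "b1 = complex_of_real (B 1)" and "b2 = complex_of_real (B 2)"
  define a2 a3 where "a2 = fps_nth F 2" and "a3 = fps_nth F 3"
  define c1 c2 where "c1 = fps_nth W 1" and "c2 = fps_nth W 2"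
  have PW: "fps_nth (P oo W) 0 = 1" "fps_nth (P oo W) 1 = b1 * c1"
      "fps_nth (P oo W) 2 = b1 * c2 + b2 * c1\<^sup>2"
    using P0 fps_compose_low_nth(1,2)[OF W0, of P]
    by (simp_all add: P_def b1_def b2_def c1_def c2_def)
  have "fps_nth (fps_deriv F * (P oo W)) 1 = 2 * a2 + b1 * c1"
    using PW F1 by (simp add: fps_mult_nth a2_def numeral_eq_Suc)
  \<comment> \<open>The left-hand side is the derivative of z f'(z), whose coefficient of degree n -
    1 is n^2 a_n; hence the factor 4 here and 9 below.\<close>
  moreover have "fps_nth (fps_deriv F + fps_X * fps_deriv (fps_deriv F)) 1 = 4 * a2"
    by (simp add: a2_def numeral_eq_Suc)
  ultimately have a2: "a2 = b1 * c1 / 2"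
    by (simp add: fps_eq)
  have "fps_nth (fps_deriv F * (P oo W)) 2 = 3 * a3 + 2 * a2 * (b1 * c1) + (b1 * c2 + b2 * c1\<^sup>2)"
    using PW F1 by (simp add: fps_mult_nth a2_def a3_def numeral_eq_Suc)
  moreover have "fps_nth (fps_deriv F + fps_X * fps_deriv (fps_deriv F)) 2 = 9 * a3"
    by (simp add: a3_def numeral_eq_Suc)
  ultimately have "9 * a3 = 3 * a3 + 2 * a2 * (b1 * c1) + (b1 * c2 + b2 * c1\<^sup>2)"
    by (simp add: fps_eq)
  then have a3: "a3 = (b1 * c2 + (b2 + b1\<^sup>2) * c1\<^sup>2) / 6"
    unfolding a2 by (simp add: field_simps power2_eq_square)
  have "inv_log_coeff f 1 = - a2 / 2"
    using inv_log_coeff_1_2(1)[OF f(1) F] by (simp only: a2_def)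
  then show "inv_log_coeff f 1 = - of_real (B 1) * fps_nth W 1 / 4"
    unfolding a2 by (simp add: b1_def c1_def)
  have "inv_log_coeff f 2 = - (a3 - 3 / 2 * a2\<^sup>2) / 2"
    using inv_log_coeff_1_2(2)[OF f(1) F] by (simp add: a2_def a3_def)
  also have "\<dots> = - (b1 * c2 + (b2 - 5 / 4 * b1\<^sup>2) * c1\<^sup>2) / 12"
    unfolding a2 a3 by (simp add: field_simps power2_eq_square)
  finally show "inv_log_coeff f 2 =
      - (of_real (B 1) * fps_nth W 2 + of_real (B 2 - 5 / 4 * (B 1)\<^sup>2) * (fps_nth W 1)\<^sup>2) / 12"
    by (simp add: b1_def b2_def c1_def c2_def)
qed

section \<open>Functions in the class with a prescribed Schwarz function\<close>

text \<open>The equation says that f''/f' equals (\<open>\<phi> (\<omega> z)\<close> - 1)/z.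
  Integrating once gives the logarithm of f', and integrating its exponential gives f.\<close>

lemma class_C_exists:
  assumes \<phi>: "\<phi> holomorphic_on unit_disc" "\<phi> 0 = 1"
    and \<omega>: "\<omega> holomorphic_on unit_disc" "\<omega> 0 = 0" "\<And>z. z \<in> unit_disc \<Longrightarrow> norm (\<omega> z) < 1"
  obtains f where "f \<in> class_C \<phi>"
    "\<And>z. z \<in> unit_disc \<Longrightarrow> 1 + z * deriv (deriv f) z / deriv f z = \<phi> (\<omega> z)"
proof -
  have hol: "(\<lambda>z. \<phi> (\<omega> z)) holomorphic_on unit_disc"
    using holomorphic_on_compose_gen[OF \<omega>(1) \<phi>(1)] \<omega>(3) by (simp add: o_def image_subset_iff)
  then have "(\<lambda>z. \<phi> (\<omega> z) - 1) holomorphic_on unit_disc"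
    by (intro holomorphic_intros)
  \<comment> \<open>The singularity of the quotient at 0 is removable because
    \<open>\<phi> (\<omega> 0) = 1\<close>; \<open>q\<close> is the prescribed f''/f'.\<close>
  from Schwarz3[OF this] obtain q where q: "q holomorphic_on unit_disc"
      "\<And>z. norm z < 1 \<Longrightarrow> \<phi> (\<omega> z) - 1 = z * q z"
    using \<phi>(2) \<omega>(2) by auto
  obtain Q where Q: "\<And>z. z \<in> unit_disc \<Longrightarrow> (Q has_field_derivative q z) (at z)"
    using holomorphic_convex_primitive'[OF convex_ball open_ball q(1)]
    by (metis at_within_open open_ball)
  \<comment> \<open>This is the future f'. Subtracting \<open>Q 0\<close> yields the normalisation
    f'(0) = 1, and the exponential keeps f' free of zeros.\<close>
  define e where "e z = exp (Q z - Q 0)" for z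
  have e: "(e has_field_derivative q z * e z) (at z)" if "z \<in> unit_disc" for z
    unfolding e_def using that by (auto intro!: derivative_eq_intros Q)
  have "e holomorphic_on unit_disc"
    unfolding holomorphic_on_open[OF open_ball] using e by blast
  then obtain g where g: "\<And>z. z \<in> unit_disc \<Longrightarrow> (g has_field_derivative e z) (at z)"
    using holomorphic_convex_primitive'[OF convex_ball open_ball]
    by (metis at_within_open open_ball)
  define f where "f z = g z - g 0" for z
  have f: "(f has_field_derivative e z) (at z)" if "z \<in> unit_disc" for z
    unfolding f_def using that by (auto intro!: derivative_eq_intros g)
  then have df: "deriv f z = e z" if "z \<in> unit_disc" for z
    using that DERIV_imp_deriv by blast
  have ddf: "deriv (deriv f) z = q z * e z" if "z \<in> unit_disc" for z
  proof -
    have "\<forall>\<^sub>F w in nhds z. w \<in> unit_disc"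
      using that by (intro eventually_nhds_in_open) auto
    then have "\<forall>\<^sub>F w in nhds z. deriv f w = e w"
      by eventually_elim (rule df)
    then have "deriv (deriv f) z = deriv e z"
      by (intro deriv_cong_ev) auto
    then show ?thesis
      using e[OF that] DERIV_imp_deriv by metis
  qed
  have e0: "e z \<noteq> 0" for z
    by (simp add: e_def)
  have eq: "1 + z * deriv (deriv f) z / deriv f z = \<phi> (\<omega> z)" if "z \<in> unit_disc" for z
    using q(2)[of z] that e0[of z] by (simp add: df ddf algebra_simps)
  have "f holomorphic_on unit_disc"
    unfolding holomorphic_on_open[OF open_ball] using f by blast
  moreover have "f 0 = 0" "deriv f 0 = 1"
    using df[of 0] by (simp_all add: f_def e_def)
  ultimately have "f \<in> class_A"
    by (simp add: class_A_def)
  moreover have "(\<lambda>z. 1 + z * deriv (deriv f) z / deriv f z) \<prec>\<^sub>s \<phi>"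
    unfolding subordinate_def
  proof (intro conjI exI[of _ \<omega>] ballI)
    show "(\<lambda>z. 1 + z * deriv (deriv f) z / deriv f z) holomorphic_on unit_disc"
      using hol by (rule holomorphic_transform) (use eq in auto)
  qed (use \<phi> \<omega> eq less_imp_le in auto)
  ultimately have "f \<in> class_C \<phi>"
    using df e0 by (simp add: class_C_def)
  with eq show ?thesis
    using that by blast
qed

section \<open>The upper bound over the class and its extremal function\<close>

theorem theorem3:
  fixes \<phi> :: "complex \<Rightarrow> complex" and B :: "nat \<Rightarrow> real"
  assumes "ma_minda \<phi>"
    and "\<forall>z\<in>unit_disc. (\<lambda>n. complex_of_real (B n) * z ^ n) sums \<phi> z"
    and "\<bar>B 2 - 5 / 4 * (B 1)\<^sup>2\<bar> \<ge> B 1"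
  shows "(\<forall>f\<in>class_C \<phi>. norm (T21_inv f) \<le> (B 1)\<^sup>2 / 16 + 1 / 144 * (B 2 - 5 / 4 * (B 1)\<^sup>2)\<^sup>2)
       \<and> (\<exists>f\<in>class_C \<phi>. norm (T21_inv f) = (B 1)\<^sup>2 / 16 + 1 / 144 * (B 2 - 5 / 4 * (B 1)\<^sup>2)\<^sup>2)"
proof (intro conjI ballI)
  define M where "M = B 2 - 5 / 4 * (B 1)\<^sup>2"
  have \<phi>: "\<phi> holomorphic_on unit_disc" "\<phi> 0 = 1" "Re (deriv \<phi> 0) > 0"
    using assms(1) by (auto simp: ma_minda_def)
  have sums: "(\<lambda>n. complex_of_real (B n) * z ^ n) sums \<phi> z" if "z \<in> unit_disc" for z
    using assms(2) that by blast
  have "\<forall>\<^sub>F z in nhds 0. z \<in> unit_disc"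
    by (intro eventually_nhds_in_open) auto
  then have "\<forall>\<^sub>F z in nhds 0. (\<lambda>n. fps_nth (Abs_fps (\<lambda>n. complex_of_real (B n))) n * z ^ n) sums \<phi> z"
    by eventually_elim (use sums in simp)
  \<comment> \<open>Uniqueness of the expansion identifies the given \<open>B 1\<close> with the
    derivative at 0, so that its sign is inherited from \<open>\<phi>\<close>.\<close>
  from fps_nth_fps_expansion[OF has_fps_expansionI[OF this], of 1]
  have "complex_of_real (B 1) = deriv \<phi> 0"
    by simp
  then have B1: "B 1 \<ge> 0"
    using \<phi>(3) by (simp flip: \<open>complex_of_real (B 1) = _\<close>)
  {
    fix f assume "f \<in> class_C \<phi>"
    then obtain \<omega> where f: "f \<in> class_A" "\<And>z. z \<in> unit_disc \<Longrightarrow> deriv f z \<noteq> 0"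
      and \<omega>: "\<omega> holomorphic_on unit_disc" "\<omega> 0 = 0" "\<And>z. z \<in> unit_disc \<Longrightarrow> norm (\<omega> z) \<le> 1"
      and eq: "\<And>z. z \<in> unit_disc \<Longrightarrow> 1 + z * deriv (deriv f) z / deriv f z = \<phi> (\<omega> z)"
      unfolding class_C_def subordinate_def by blast
    from has_fps_expansion_fps_expansion[OF open_ball _ \<omega>(1)]
    obtain W where W: "\<omega> has_fps_expansion W"
      by auto
    have \<Gamma>: "inv_log_coeff f 1 = - of_real (B 1) * fps_nth W 1 / 4"
        "inv_log_coeff f 2 = - (of_real (B 1) * fps_nth W 2 + of_real M * (fps_nth W 1)\<^sup>2) / 12"
      unfolding M_def by (rule inv_log_coeff_convex[OF f sums \<phi>(2) W \<omega>(2) eq]; assumption)+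
    define s where "s = (norm (fps_nth W 1))\<^sup>2"
    have c2: "norm (fps_nth W 2) \<le> 1 - s"
      unfolding s_def by (rule schwarz_function_coeffs[OF \<omega> W])
    then have s: "s \<le> 1" "0 \<le> s"
      using norm_ge_zero[of "fps_nth W 2"] by (auto simp: s_def simp del: norm_ge_zero)
    have "norm ((inv_log_coeff f 1)\<^sup>2) = (B 1)\<^sup>2 / 16 * s"
      unfolding \<Gamma>(1) s_def by (simp add: norm_mult norm_divide norm_power power_mult_distrib power_divide)
    also have "\<dots> \<le> (B 1)\<^sup>2 / 16"
      using s by (intro mult_left_le) auto
    finally have 1: "norm ((inv_log_coeff f 1)\<^sup>2) \<le> (B 1)\<^sup>2 / 16" .
    have "norm (of_real (B 1) * fps_nth W 2 + of_real M * (fps_nth W 1)\<^sup>2)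
        \<le> B 1 * norm (fps_nth W 2) + \<bar>M\<bar> * s"
      using B1 by (intro norm_triangle_le) (simp add: norm_mult norm_power s_def)
    \<comment> \<open>The hypothesis \<open>B 1 \<le> \<bar>M\<bar>\<close> enters here: both terms
      then carry the factor \<open>\<bar>M\<bar>\<close>, with weights \<open>1 - s\<close> and
      \<open>s\<close> adding up to 1.\<close>
    also have "\<dots> \<le> \<bar>M\<bar> * (1 - s) + \<bar>M\<bar> * s"
      using assms(3) B1 c2 s by (intro add_right_mono mult_mono) (auto simp: M_def)
    finally have "norm (of_real (B 1) * fps_nth W 2 + of_real M * (fps_nth W 1)\<^sup>2) \<le> \<bar>M\<bar>"
      by (simp add: algebra_simps)
    then have "norm (inv_log_coeff f 2) \<le> \<bar>M\<bar> / 12"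
      unfolding \<Gamma>(2) by (simp add: norm_divide del: minus_add_distrib)
    then have "(norm (inv_log_coeff f 2))\<^sup>2 \<le> (\<bar>M\<bar> / 12)\<^sup>2"
      by (intro power_mono) auto
    then have "norm ((inv_log_coeff f 2)\<^sup>2) \<le> 1 / 144 * M\<^sup>2"
      by (simp add: norm_power power_divide)
    with 1 have "norm (T21_inv f) \<le> (B 1)\<^sup>2 / 16 + 1 / 144 * M\<^sup>2"
      unfolding T21_inv_def using norm_triangle_ineq4 by (meson add_mono order_trans)
    then show "norm (T21_inv f) \<le> (B 1)\<^sup>2 / 16 + 1 / 144 * (B 2 - 5 / 4 * (B 1)\<^sup>2)\<^sup>2"
      by (simp only: M_def)
  }
  obtain f where f: "f \<in> class_C \<phi>"
      "\<And>z. z \<in> unit_disc \<Longrightarrow> 1 + z * deriv (deriv f) z / deriv f z = \<phi> (\<i> * z)"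
    by (rule class_C_exists[OF \<phi>(1,2), of "\<lambda>z. \<i> * z"])
      (auto simp: norm_mult intro!: holomorphic_intros)
  have W: "(\<lambda>z. \<i> * z) has_fps_expansion fps_const \<i> * fps_X"
    by (intro fps_expansion_intros)
  have "f \<in> class_A" "\<And>z. z \<in> unit_disc \<Longrightarrow> deriv f z \<noteq> 0"
    using f(1) by (auto simp: class_C_def)
  \<comment> \<open>The Schwarz function has first coefficient \<open>\<i>\<close> and second
    coefficient 0; as \<open>\<i>\<close> squares to -1, the minus sign in the formula for the
    second logarithmic coefficient cancels.\<close>
  from inv_log_coeff_convex[OF this sums \<phi>(2) W _ f(2), folded M_def]
  have \<Gamma>: "inv_log_coeff f 1 = - of_real (B 1) * \<i> / 4" "inv_log_coeff f 2 = of_real M / 12"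
    by simp_all
  have "T21_inv f = - of_real ((B 1)\<^sup>2 / 16 + 1 / 144 * M\<^sup>2)"
    unfolding T21_inv_def \<Gamma> by (simp add: power_divide power_mult_distrib)
  then have "norm (T21_inv f) = (B 1)\<^sup>2 / 16 + 1 / 144 * M\<^sup>2"
    by (simp only: norm_minus_cancel norm_of_real) simp
  with f(1) show "\<exists>f\<in>class_C \<phi>. norm (T21_inv f) = (B 1)\<^sup>2 / 16 + 1 / 144 * (B 2 - 5 / 4 * (B 1)\<^sup>2)\<^sup>2"
    unfolding M_def by blast
qed

end
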